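(* For all $n,m\ge2$, $C(S^1)_{(n)}\otimes_{\min}C(S^1)_{(m)}\neq C(S^1)_{(n)}\otimes_{\max}C(S^1)_{(m)}$; that is, the identity map on the algebraic tensor product is not a complete order isomorphism between these two operator system structures.
   Context: $C(S^1)_{(n)}$: operator system of continuous functions $f$ on the unit circle $S^1$ with Fourier coefficients $\hat f(k)=0$ for $|k|\ge n$; $F\in M_p(C(S^1)_{(n)})$ positive iff $F(z)\ge0$ for all $z\in S^1$; unit the constant $1$. For operator systems $\mathcal R\subseteq B(\mathcal H)$, $\mathcal S\subseteq B(\mathcal K)$, $\mathcal R\otimes_{\min}\mathcal S$ is the algebraic tensor product with matrix order inherited from $B(\mathcal H\otimes\mathcal K)$. $\mathcal R\otimes_{\max}\mathcal S$: $x\in M_p(\mathcal R\otimes\mathcal S)$ is positive iff for every $\varepsilon>0$ there exist $a\in M_k(\mathcal R)_+$, $b\in M_l(\mathcal S)_+$ and a linear $\delta:\mathbb C^p\to\mathbb C^k\otimes\mathbb C^l$ with $\varepsilon(e_{\mathcal R}\otimes e_{\mathcal S})_p+x=\delta^*(a\otimes b)\delta$. *)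

theory Defs
  imports Complex_Main
begin

text \<open>Elements of C(S^1)_(n) are represented by their Fourier coefficients
  a :: int => complex, with a k = 0 for |k| >= n (such a function is a
  trigonometric polynomial, uniquely determined by its coefficients).\<close>

definition trig_poly :: "nat \<Rightarrow> (int \<Rightarrow> complex) \<Rightarrow> bool" where
  "trig_poly n a \<longleftrightarrow> (\<forall>k. \<bar>k\<bar> \<ge> int n \<longrightarrow> a k = 0)"

definition trig_eval :: "nat \<Rightarrow> (int \<Rightarrow> complex) \<Rightarrow> complex \<Rightarrow> complex" where
  "trig_eval n a z = (\<Sum>k\<in>{-(int n)<..<int n}. a k * z powi k)"

text \<open>Elements of the algebraic tensor product C(S^1)_(n) (x) C(S^1)_(m):
  coefficient arrays c j k (coefficient of z^j (x) w^k).\<close>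

definition trig2 :: "nat \<Rightarrow> nat \<Rightarrow> (int \<Rightarrow> int \<Rightarrow> complex) \<Rightarrow> bool" where
  "trig2 n m c \<longleftrightarrow> (\<forall>j k. (\<bar>j\<bar> \<ge> int n \<or> \<bar>k\<bar> \<ge> int m) \<longrightarrow> c j k = 0)"

definition trig2_eval :: "nat \<Rightarrow> nat \<Rightarrow> (int \<Rightarrow> int \<Rightarrow> complex) \<Rightarrow> complex \<Rightarrow> complex \<Rightarrow> complex" where
  "trig2_eval n m c z w =
     (\<Sum>j\<in>{-(int n)<..<int n}. \<Sum>k\<in>{-(int m)<..<int m}. c j k * z powi j * w powi k)"

definition psd :: "nat \<Rightarrow> (nat \<Rightarrow> nat \<Rightarrow> complex) \<Rightarrow> bool" where
  "psd p M \<longleftrightarrow> (\<forall>v :: nat \<Rightarrow> complex.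
      let s = (\<Sum>i<p. \<Sum>j<p. cnj (v i) * M i j * v j) in Im s = 0 \<and> Re s \<ge> 0)"

definition mat_trig :: "nat \<Rightarrow> nat \<Rightarrow> (nat \<Rightarrow> nat \<Rightarrow> int \<Rightarrow> complex) \<Rightarrow> bool" where
  "mat_trig n p F \<longleftrightarrow> (\<forall>i<p. \<forall>j<p. trig_poly n (F i j))"

definition pos_trig :: "nat \<Rightarrow> nat \<Rightarrow> (nat \<Rightarrow> nat \<Rightarrow> int \<Rightarrow> complex) \<Rightarrow> bool" where
  "pos_trig n p F \<longleftrightarrow> mat_trig n p F \<and>
     (\<forall>z. cmod z = 1 \<longrightarrow> psd p (\<lambda>i j. trig_eval n (F i j) z))"

definition mat_tens :: "nat \<Rightarrow> nat \<Rightarrow> nat \<Rightarrow> (nat \<Rightarrow> nat \<Rightarrow> int \<Rightarrow> int \<Rightarrow> complex) \<Rightarrow> bool" where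
  "mat_tens n m p X \<longleftrightarrow> (\<forall>i<p. \<forall>j<p. trig2 n m (X i j))"

text \<open>Min tensor positivity: inherited from B(L^2(S^1) (x) L^2(S^1)) via multiplication
  operators, i.e. pointwise positivity on S^1 x S^1.\<close>

definition min_pos :: "nat \<Rightarrow> nat \<Rightarrow> nat \<Rightarrow> (nat \<Rightarrow> nat \<Rightarrow> int \<Rightarrow> int \<Rightarrow> complex) \<Rightarrow> bool" where
  "min_pos n m p X \<longleftrightarrow>
     (\<forall>z w. cmod z = 1 \<longrightarrow> cmod w = 1 \<longrightarrow> psd p (\<lambda>i j. trig2_eval n m (X i j) z w))"

text \<open>Max tensor positivity: for every eps > 0, eps (1 (x) 1)_p + X = delta^* (a (x) b) delta
  with a in M_k(R)_+, b in M_l(S)_+, delta : C^p -> C^k (x) C^l (indexed by pairs).\<close>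

definition max_pos :: "nat \<Rightarrow> nat \<Rightarrow> nat \<Rightarrow> (nat \<Rightarrow> nat \<Rightarrow> int \<Rightarrow> int \<Rightarrow> complex) \<Rightarrow> bool" where
  "max_pos n m p X \<longleftrightarrow>
     (\<forall>\<epsilon>::real. \<epsilon> > 0 \<longrightarrow>
       (\<exists>k l a b (\<delta> :: nat \<times> nat \<Rightarrow> nat \<Rightarrow> complex).
          k > 0 \<and> l > 0 \<and> pos_trig n k a \<and> pos_trig m l b \<and>
          (\<forall>r<p. \<forall>s<p. \<forall>j t.
             (if r = s \<and> j = 0 \<and> t = 0 then complex_of_real \<epsilon> else 0) + X r s j t =
             (\<Sum>x\<in>{..<k} \<times> {..<l}. \<Sum>y\<in>{..<k} \<times> {..<l}.
                cnj (\<delta> x r) * (a (fst x) (fst y) j * b (snd x) (snd y) t) * \<delta> y s))))"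

end

theory Submission
  imports Defs
begin

text \<open>By Fejer--Riesz, elements that are positive for the maximal structure are sums of squares of
  analytic polynomials of bidegree at most (n-1, m-1), so a functional that is nonnegative on such
  squares is nonnegative on them. Send \<open>z\<^sup>N w\<^sup>M\<close> and \<open>z\<^sup>N w\<^sup>-\<^sup>M\<close>, with N = n-1 and M = m-1, to two
  noncommuting unitary matrices, 1 to the identity and all other monomials not adjoint to these to
  0. This map is completely positive on sums of squares, but it has no completely positive extension
  to \<open>C(S\<^sup>1 \<times> S\<^sup>1)\<close>, since there both monomials would be compressions of commuting unitaries, and a unitary
  compression is reducing. Pairing with the maximally entangled vector gives a functional that is
  negative on an explicit pointwise positive 2 by 2 matrix.\<close>

section \<open>Elementary facts on positive semidefinite matrices\<close>

lemma psd_form: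
  assumes "psd n M"
  shows "Im (\<Sum>i<n. \<Sum>j<n. cnj (v i) * M i j * v j) = 0"
    and "Re (\<Sum>i<n. \<Sum>j<n. cnj (v i) * M i j * v j) \<ge> 0"
  using assms unfolding psd_def Let_def by blast+

lemma psd_two:
  assumes "psd n M" "i < n" "j < n" "i \<noteq> j"
  defines "s x y \<equiv> cnj x * M i i * x + cnj x * M i j * y + cnj y * M j i * x + cnj y * M j j * y"
  shows "Im (s x y) = 0" "Re (s x y) \<ge> 0"
proof -
  define v where "v = (\<lambda>l. if l = i then x else if l = j then y else 0)"
  have *: "(\<Sum>l<n. f l) = f i + f j" if "\<And>l. l \<noteq> i \<Longrightarrow> l \<noteq> j \<Longrightarrow> f l = 0" for f :: "nat \<Rightarrow> complex"
  proof -
    have "(\<Sum>l<n. f l) = (\<Sum>l\<in>{i,j}. f l)"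
      by (rule sum.mono_neutral_right) (use assms that in auto)
    then show ?thesis using assms by simp
  qed
  have "(\<Sum>l<n. \<Sum>l'<n. cnj (v l) * M l l' * v l') = s x y"
    using assms(4) by (subst *, simp add: v_def, subst *, simp add: v_def, subst *, simp add: v_def)
      (simp add: v_def s_def)
  with psd_form[OF assms(1), of v] show "Im (s x y) = 0" "Re (s x y) \<ge> 0" by auto
qed

lemma psd_diag:
  assumes "psd n M" "i < n"
  shows "Im (M i i) = 0" "Re (M i i) \<ge> 0"
proof -
  define v :: "nat \<Rightarrow> complex" where "v = (\<lambda>l. if l = i then 1 else 0)"
  have "(\<Sum>l<n. \<Sum>l'<n. cnj (v l) * M l l' * v l') = M i i"
    using assms(2) by (simp add: v_def if_distrib[of cnj] if_distrib[of "(*) _"] if_distrib[of "\<lambda>x. x * _"] cong: if_cong)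
  with psd_form[OF assms(1), of v] show "Im (M i i) = 0" "Re (M i i) \<ge> 0" by auto
qed

text \<open>\<open>psd\<close> only demands that the quadratic form be real and nonnegative, so
  symmetry comes from polarization: realness at the vector with entries 1, 1 compares the imaginary
  parts, at 1, \<open>\<i>\<close> the real parts.\<close>

lemma psd_hermitian:
  assumes "psd n M" "i < n" "j < n"
  shows "M j i = cnj (M i j)"
proof (cases "i = j")
  case True
  then show ?thesis using psd_diag[OF assms(1,2)] by (simp add: complex_eq_iff)
next
  case False
  note d = psd_diag(1)[OF assms(1,2)] psd_diag(1)[OF assms(1,3)]
  show ?thesis
    using psd_two(1)[OF assms False, of 1 1] psd_two(1)[OF assms False, of 1 \<i>] d
    by (simp add: complex_eq_iff)
qed

text \<open>With \<open>g = M i j\<close>, the form at the vector with entries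
  \<open>- s * g\<close> and 1 is affine in \<open>s\<close> with slope
  \<open>- 2 * (cmod g)\<^sup>2\<close>, so it can stay nonnegative for all real \<open>s\<close>
  only if \<open>g = 0\<close>.\<close>

lemma psd_zero_row:
  assumes "psd n M" "i < n" "j < n" "M i i = 0"
  shows "M i j = 0"
proof (cases "i = j")
  case False
  define r where "r = Re (M j j)"
  have r: "M j j = of_real r"
    using psd_diag[OF assms(1,3)] by (auto simp: r_def complex_eq_iff)
  define g where "g = M i j"
  have h: "M j i = cnj g" using psd_hermitian[OF assms(1-3)] by (simp add: g_def)
  define c where "c = (cmod g)\<^sup>2"
  have gg: "g * cnj g = of_real c"
    by (simp add: c_def complex_norm_square[symmetric])
  have *: "0 \<le> r - 2 * s * c" for s :: real
  proof -
    have "0 \<le> Re (cnj (- of_real s * g) * M i i * (- of_real s * g)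
        + cnj (- of_real s * g) * M i j * 1 + cnj 1 * M j i * (- of_real s * g) + cnj 1 * M j j * 1)"
      by (rule psd_two(2)[OF assms(1-3) False])
    also have "\<dots> = Re (of_real r - of_real (2 * s) * (g * cnj g))"
      unfolding assms(4) h r g_def[symmetric] by (simp add: algebra_simps)
    also have "\<dots> = r - 2 * s * c" unfolding gg by simp
    finally show ?thesis .
  qed
  have "c = 0"
  proof (rule ccontr)
    \<comment> \<open>At \<open>s = (r + 1) / c\<close> the inequality reads
      \<open>0 \<le> - r - 2\<close>, while \<open>s = 0\<close> gives
      \<open>0 \<le> r\<close>.\<close>
    assume "c \<noteq> 0"
    with *[of "(r + 1) / c"] *[of 0] show False by simp
  qed
  then show ?thesis by (simp add: c_def g_def)
qed (use assms in simp)

section \<open>Schur complements and banded Cholesky factorization\<close>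

text \<open>Completing the square: the form of the complement at \<open>v\<close> is the form of
  \<open>M\<close> at \<open>v - e\<close>, where \<open>e\<close> changes only coordinate
  \<open>t\<close> and makes the entry \<open>t\<close> of \<open>M (v - e)\<close> vanish.\<close>

lemma psd_schur_complement:
  assumes M: "psd n M" and t: "t < n" and nz: "M t t \<noteq> 0"
  shows "psd n (\<lambda>i j. M i j - M i t * cnj (M j t) / M t t)"
  unfolding psd_def Let_def
proof (intro allI)
  fix v :: "nat \<Rightarrow> complex"
  define d where "d = M t t"
  have cd: "cnj d = d" using psd_diag[OF M t] by (simp add: d_def complex_eq_iff)
  have d0: "d \<noteq> 0" using nz by (simp add: d_def)
  define g where "g = (\<Sum>j<n. M t j * v j)"
  have herm: "M i t = cnj (M t i)" if "i < n" for i using psd_hermitian[OF M t that] .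
  have g': "(\<Sum>i<n. cnj (v i) * M i t) = cnj g"
    by (simp add: g_def herm mult.commute)
  define e :: "nat \<Rightarrow> complex" where "e = (\<lambda>i. if i = t then g / d else 0)"
  have e1: "(\<Sum>i<n. cnj (e i) * f i) = cnj (g / d) * f t" for f
    using t by (simp add: e_def if_distrib[of cnj] if_distribR if_distrib[of "\<lambda>x. x * _"] sum.delta cong: if_cong)
  have e2: "(\<Sum>i<n. f i * e i) = f t * (g / d)" for f
    using t by (simp add: e_def if_distrib[of "(*) _"] sum.delta cong: if_cong)
  have "(\<Sum>i<n. \<Sum>j<n. cnj (v i - e i) * M i j * (v j - e j))
      = (\<Sum>i<n. \<Sum>j<n. cnj (v i) * M i j * v j) - (\<Sum>i<n. \<Sum>j<n. cnj (v i) * M i j * e j)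
        - (\<Sum>i<n. \<Sum>j<n. cnj (e i) * M i j * v j) + (\<Sum>i<n. \<Sum>j<n. cnj (e i) * M i j * e j)"
    by (simp add: algebra_simps sum.distrib sum_subtractf)
  also have "(\<Sum>i<n. \<Sum>j<n. cnj (v i) * M i j * e j) = cnj g * (g / d)"
    by (simp only: e2 g' sum_distrib_right[symmetric])
  also have "(\<Sum>i<n. \<Sum>j<n. cnj (e i) * M i j * v j) = cnj (g / d) * g"
    by (simp only: mult.assoc sum_distrib_left[symmetric] e1 g_def)
  also have "(\<Sum>i<n. \<Sum>j<n. cnj (e i) * M i j * e j) = cnj (g / d) * d * (g / d)"
    by (simp only: e2, simp only: mult.assoc e1 d_def)
  also have "(\<Sum>i<n. \<Sum>j<n. cnj (v i) * M i j * v j) - cnj g * (g / d) - cnj (g / d) * g + cnj (g / d) * d * (g / d)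
      = (\<Sum>i<n. \<Sum>j<n. cnj (v i) * M i j * v j) - cnj g * g / d"
    using d0 cd by simp
  finally have form: "(\<Sum>i<n. \<Sum>j<n. cnj (v i - e i) * M i j * (v j - e j))
      = (\<Sum>i<n. \<Sum>j<n. cnj (v i) * M i j * v j) - cnj g * g / d" .
  have "(\<Sum>i<n. \<Sum>j<n. cnj (v i) * (M i t * cnj (M j t) / d) * v j)
      = (\<Sum>i<n. cnj (v i) * M i t) * (\<Sum>j<n. cnj (M j t) * v j) / d"
    by (simp only: sum_product sum_divide_distrib) (simp add: mult_ac)
  also have "(\<Sum>j<n. cnj (M j t) * v j) = g" by (simp add: g_def herm)
  finally have "(\<Sum>i<n. \<Sum>j<n. cnj (v i) * (M i j - M i t * cnj (M j t) / d) * v j)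
      = (\<Sum>i<n. \<Sum>j<n. cnj (v i - e i) * M i j * (v j - e j))"
    unfolding form g' by (simp only: right_diff_distrib left_diff_distrib sum_subtractf)
  then show "Im (\<Sum>i<n. \<Sum>j<n. cnj (v i) * (M i j - M i t * cnj (M j t) / M t t) * v j) = 0 \<and>
      0 \<le> Re (\<Sum>i<n. \<Sum>j<n. cnj (v i) * (M i j - M i t * cnj (M j t) / M t t) * v j)"
    using psd_form[OF M, of "\<lambda>i. v i - e i"] by (simp add: d_def)
qed

text \<open>One elimination step with pivot \<open>t\<close>. The profile \<open>h\<close> bounds
  the last nonzero row of each column; its monotonicity is what prevents fill-in outside the
  band.\<close>

lemma cholesky_step:
  fixes h :: "nat \<Rightarrow> nat"
  assumes M: "psd n M" and t: "t < n" and h: "mono h"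
    and band: "\<And>i j. j \<le> i \<Longrightarrow> i < n \<Longrightarrow> h j < i \<Longrightarrow> M i j = 0"
    and zero: "\<And>i j. i < n \<Longrightarrow> j < n \<Longrightarrow> i < t \<or> j < t \<Longrightarrow> M i j = 0"
  obtains N l where "psd n N"
    "\<And>i j. j \<le> i \<Longrightarrow> i < n \<Longrightarrow> h j < i \<Longrightarrow> N i j = 0"
    "\<And>i j. i < n \<Longrightarrow> j < n \<Longrightarrow> i < Suc t \<or> j < Suc t \<Longrightarrow> N i j = 0"
    "\<And>i j. i < n \<Longrightarrow> j < n \<Longrightarrow> M i j = l i * cnj (l j) + N i j"
    "\<And>i. l i \<noteq> 0 \<Longrightarrow> t \<le> i \<and> i \<le> h t"
proof (cases "M t t = 0")
  case True
  \<comment> \<open>A zero pivot forces its whole row and column to vanish, so nothing has to be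
    eliminated.\<close>
  have row: "M t j = 0" if "j < n" for j using psd_zero_row[OF M t that True] .
  have col: "M j t = 0" if "j < n" for j using psd_hermitian[OF M t that] row[OF that] by simp
  show ?thesis
    by (rule that[of M "\<lambda>_. 0"]) (use M band zero row col in \<open>auto simp: less_Suc_eq\<close>)
next
  case False
  define d where "d = Re (M t t)"
  have d: "M t t = of_real d" "d > 0"
    using psd_diag[OF M t] False by (auto simp: d_def complex_eq_iff)
  define l where "l = (\<lambda>i. if i < n then M i t / of_real (sqrt d) else 0)"
  define N where "N = (\<lambda>i j. M i j - M i t * cnj (M j t) / M t t)"
  have ll: "l i * cnj (l j) = M i t * cnj (M j t) / M t t" if "i < n" "j < n" for i j
  proof -
    have "complex_of_real (sqrt d) * complex_of_real (sqrt d) = of_real d"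
      using d(2) by (simp flip: of_real_mult)
    with that show ?thesis by (simp add: l_def d(1))
  qed
  show ?thesis
  proof (rule that[of N l])
    show "psd n N" unfolding N_def by (rule psd_schur_complement[OF M t False])
    show "N i j = 0" if ij: "j \<le> i" "i < n" "h j < i" for i j
    proof (cases "j < t")
      case True
      with ij zero[of i j] zero[of j t] t show ?thesis by (simp add: N_def)
    next
      case False
      \<comment> \<open>No fill-in: row \<open>i\<close> lies below the profile of column
        \<open>j\<close>, hence also below that of the earlier column \<open>t\<close>, and the rank
        one correction is zero at this entry.\<close>
      then have "h t < i" "t \<le> i" using monoD[OF h, of t j] ij by auto
      with ij band[of j i] band[of t i] show ?thesis by (simp add: N_def)
    qed
    show "N i j = 0" if ij: "i < n" "j < n" "i < Suc t \<or> j < Suc t" for i j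
    proof -
      have "M i t = cnj (M t i)" "M t j = cnj (M j t)" "cnj (M t t) = M t t"
        using psd_hermitian[OF M t ij(1)] psd_hermitian[OF M ij(2) t] psd_hermitian[OF M t t] by auto
      then show ?thesis
        using ij zero[of i j] zero[of i t] zero[of j t] t False by (auto simp: N_def less_Suc_eq)
    qed
    show "M i j = l i * cnj (l j) + N i j" if "i < n" "j < n" for i j
      using ll[OF that] by (simp add: N_def)
    show "t \<le> i \<and> i \<le> h t" if "l i \<noteq> 0" for i
    proof -
      have "i < n" "M i t \<noteq> 0" using that by (auto simp: l_def split: if_splits)
      then show ?thesis using zero[of i t] band[of t i] t by force
    qed
  qed
qed

text \<open>\<open>L r\<close> is the column split off in step \<open>r\<close>. It starts at row
  \<open>r\<close> because the earlier rows are already cleared, and it ends at \<open>h r\<close>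
  because elimination respects the profile.\<close>

lemma banded_cholesky:
  fixes h :: "nat \<Rightarrow> nat"
  assumes "psd n M" and h: "mono h"
    and "\<And>i j. j \<le> i \<Longrightarrow> i < n \<Longrightarrow> h j < i \<Longrightarrow> M i j = 0"
  obtains L where "\<And>i j. i < n \<Longrightarrow> j < n \<Longrightarrow> M i j = (\<Sum>r<n. L r i * cnj (L r j))"
    and "\<And>r i. L r i \<noteq> 0 \<Longrightarrow> r \<le> i \<and> i \<le> h r"
proof -
  \<comment> \<open>Invariant after \<open>t\<close> steps: \<open>N\<close> is the remainder, with
    its first \<open>t\<close> rows and columns cleared. At \<open>t = n\<close> nothing
    remains.\<close>
  define Q where "Q t L N \<longleftrightarrow> psd n N \<and> (\<forall>i j. j \<le> i \<longrightarrow> i < n \<longrightarrow> h j < i \<longrightarrow> N i j = 0) \<and>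
      (\<forall>i j. i < n \<longrightarrow> j < n \<longrightarrow> i < t \<or> j < t \<longrightarrow> N i j = 0) \<and>
      (\<forall>i j. i < n \<longrightarrow> j < n \<longrightarrow> M i j = (\<Sum>r<t. L r i * cnj (L r j)) + N i j) \<and>
      (\<forall>r i. L r i \<noteq> 0 \<longrightarrow> r \<le> i \<and> i \<le> h r)" for t L N
  have "\<exists>L N. Q t L N" if "t \<le> n" for t
    using that
  proof (induction t)
    case 0
    have "Q 0 (\<lambda>_ _. 0) M" using assms by (simp add: Q_def)
    then show ?case by blast
  next
    case (Suc t)
    then obtain L N where "Q t L N" by auto
    then have LN: "psd n N" "\<And>i j. j \<le> i \<Longrightarrow> i < n \<Longrightarrow> h j < i \<Longrightarrow> N i j = 0"
      "\<And>i j. i < n \<Longrightarrow> j < n \<Longrightarrow> i < t \<or> j < t \<Longrightarrow> N i j = 0"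
      "\<And>i j. i < n \<Longrightarrow> j < n \<Longrightarrow> M i j = (\<Sum>r<t. L r i * cnj (L r j)) + N i j"
      "\<And>r i. L r i \<noteq> 0 \<Longrightarrow> r \<le> i \<and> i \<le> h r"
      unfolding Q_def by blast+
    have "t < n" using Suc.prems by simp
    from cholesky_step[OF LN(1) \<open>t < n\<close> h LN(2,3)] obtain N' l where N': "psd n N'"
      "\<And>i j. j \<le> i \<Longrightarrow> i < n \<Longrightarrow> h j < i \<Longrightarrow> N' i j = 0"
      "\<And>i j. i < n \<Longrightarrow> j < n \<Longrightarrow> i < Suc t \<or> j < Suc t \<Longrightarrow> N' i j = 0"
      "\<And>i j. i < n \<Longrightarrow> j < n \<Longrightarrow> N i j = l i * cnj (l j) + N' i j"
      "\<And>i. l i \<noteq> 0 \<Longrightarrow> t \<le> i \<and> i \<le> h t"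
      by blast
    have "M i j = (\<Sum>r<Suc t. (L(t := l)) r i * cnj ((L(t := l)) r j)) + N' i j"
      if "i < n" "j < n" for i j
      using LN(4)[OF that] N'(4)[OF that] by simp
    moreover have "r \<le> i \<and> i \<le> h r" if "(L(t := l)) r i \<noteq> 0" for r i
      using that LN(5) N'(5) by (cases "r = t") auto
    ultimately have "Q (Suc t) (L(t := l)) N'"
      unfolding Q_def using N'(1,2,3) by blast
    then show ?case by blast
  qed
  from this[of n] obtain L N where "Q n L N" by auto
  then show ?thesis by (intro that[of L]) (auto simp: Q_def)
qed


section \<open>Block Toeplitz matrices and approximate Fejer-Riesz factorization\<close>

text \<open>Orthogonality of characters as a geometric sum; in the given range 0 is the only
  multiple of \<open>R\<close>.\<close>

lemma sum_roots_of_unity_powi: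
  assumes "\<bar>q\<bar> < int R"
  shows "(\<Sum>t<R. cis (2 * pi * real t / real R) powi q) = (if q = 0 then of_nat R else 0)"
proof (cases "q = 0")
  case False
  have R: "real R > 0" using assms by linarith
  define z where "z = cis (of_int q * (2 * pi / real R))"
  have pow: "cis (2 * pi * real t / real R) powi q = z ^ t" for t
    by (simp add: z_def cis_power_int DeMoivre mult_ac)
  have "z \<noteq> 1"
  proof
    assume "z = 1"
    then have "cos (of_int q * (2 * pi / real R)) = 1" by (simp add: z_def complex_eq_iff)
    then obtain m :: int where "of_int q * (2 * pi / real R) = of_int m * 2 * pi"
      by (auto simp: cos_one_2pi_int)
    then have "real_of_int q = of_int (m * int R)" using R by (simp add: field_simps)
    then have "q = m * int R" by (simp only: of_int_eq_iff)
    with assms False show False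
      by (metis abs_mult abs_of_nat dvd_imp_le_int dvd_triv_right leD)
  qed
  moreover have "z ^ R = cis (2 * pi * of_int q)"
    using R by (simp add: z_def DeMoivre mult_ac)
  ultimately show ?thesis using False by (simp add: pow geometric_sum)
qed simp

text \<open>A flat index \<open>r\<close> encodes entry \<open>r mod k\<close> of block
  \<open>r div k\<close>. This lets a form of size \<open>k\<close>, taken at a sum over blocks, be
  rewritten as a form in flat indices.\<close>

lemma sum_mod_fibres:
  assumes "k > (0::nat)"
  shows "(\<Sum>j<k. f j * (\<Sum>r\<in>S. if r mod k = j then w r else 0)) = (\<Sum>r\<in>S. f (r mod k) * (w r :: complex))"
proof -
  have "(\<Sum>j<k. f j * (\<Sum>r\<in>S. if r mod k = j then w r else 0))
      = (\<Sum>r\<in>S. \<Sum>j<k. if j = r mod k then f j * w r else 0)"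
    by (subst sum.swap) (auto simp: sum_distrib_left intro!: sum.cong)
  then show ?thesis using assms by simp
qed

text \<open>The quadratic form of the matrix is the mean of that of the trigonometric polynomial over
  the circle, taken at the vectors with entries \<open>\<Sum>\<^sub>J z^((n-1)J) v\<^sub>J\<close>; a mean over sufficiently
  many roots of unity suffices.\<close>

lemma psd_block_toeplitz:
  assumes a: "pos_trig n k a" and "k > 0"
  shows "psd (K * k) (\<lambda>q r. a (q mod k) (r mod k) ((int n - 1) * (int (q div k) - int (r div k))))"
  unfolding psd_def Let_def
proof (intro allI)
  fix v :: "nat \<Rightarrow> complex"
  define N where "N = int n - 1"
  define I where "I = {- int n<..<int n}"
  define e where "e = (\<lambda>q. N * int (q div k))"
  \<comment> \<open>All frequencies \<open>l + (e r - e q)\<close> below have modulus less than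
    \<open>R\<close>, so the average over the roots of unity picks out Fourier coefficients
    exactly.\<close>
  define R where "R = n + nat (\<bar>N\<bar> * int K) + 1"
  have "R > 0" by (simp add: R_def)
  define \<omega> where "\<omega> = (\<lambda>t. cis (2 * pi * real t / real R))"
  define form where "form = (\<lambda>z. \<Sum>q<K*k. \<Sum>r<K*k. cnj (z powi e q * v q) * trig_eval n (a (q mod k) (r mod k)) z * (z powi e r * v r))"
  have form_pos: "Im (form z) = 0 \<and> Re (form z) \<ge> 0" if z: "cmod z = 1" for z
  proof -
    define w where "w = (\<lambda>q. z powi e q * v q)"
    define u where "u = (\<lambda>j. \<Sum>q<K*k. if q mod k = j then w q else 0)"
    have cu: "cnj (u i) = (\<Sum>q<K*k. if q mod k = i then cnj (w q) else 0)" for i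
      by (simp add: u_def if_distrib[of cnj] cong: if_cong)
    have "(\<Sum>i<k. \<Sum>j<k. cnj (u i) * trig_eval n (a i j) z * u j)
        = (\<Sum>i<k. (\<Sum>j<k. trig_eval n (a i j) z * u j) * cnj (u i))"
      by (simp add: sum_distrib_left sum_distrib_right mult_ac)
    also have "\<dots> = (\<Sum>i<k. (\<Sum>r<K*k. trig_eval n (a i (r mod k)) z * w r) * cnj (u i))"
      by (simp only: u_def sum_mod_fibres[OF \<open>k > 0\<close>])
    also have "\<dots> = (\<Sum>q<K*k. (\<Sum>r<K*k. trig_eval n (a (q mod k) (r mod k)) z * w r) * cnj (w q))"
      unfolding cu by (rule sum_mod_fibres[OF \<open>k > 0\<close>])
    also have "\<dots> = form z" by (simp add: form_def w_def sum_distrib_left sum_distrib_right mult_ac)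
    finally have "(\<Sum>i<k. \<Sum>j<k. cnj (u i) * trig_eval n (a i j) z * u j) = form z" .
    moreover have "psd k (\<lambda>i j. trig_eval n (a i j) z)" using a z by (simp add: pos_trig_def)
    ultimately show ?thesis using psd_form[of k "\<lambda>i j. trig_eval n (a i j) z" u] by simp
  qed
  have eb: "\<bar>e r - e q\<bar> \<le> \<bar>N\<bar> * int K" if "q < K * k" "r < K * k" for q r
  proof -
    have "q div k < K" "r div k < K" using that by (auto simp: less_mult_imp_div_less)
    then have "\<bar>int (r div k) - int (q div k)\<bar> \<le> int K" by linarith
    then show ?thesis by (simp add: e_def abs_mult mult_left_mono flip: right_diff_distrib)
  qed
  have coeff: "(\<Sum>t<R. cnj (\<omega> t powi e q) * trig_eval n (a (q mod k) (r mod k)) (\<omega> t) * \<omega> t powi e r)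
      = of_nat R * a (q mod k) (r mod k) (e q - e r)" if qr: "q < K * k" "r < K * k" for q r
  proof -
    define b where "b = a (q mod k) (r mod k)"
    have "trig_poly n b" using a \<open>k > 0\<close> by (simp add: b_def pos_trig_def mat_trig_def)
    then have b: "b l = 0" if "l \<notin> I" for l using that by (auto simp: trig_poly_def I_def)
    have \<omega>: "\<omega> t \<noteq> 0" "cnj (\<omega> t powi l) = \<omega> t powi (- l)" for t l
      by (simp_all add: \<omega>_def cis_power_int cis_cnj)
    have pw: "cnj (\<omega> t powi e q) * \<omega> t powi l * \<omega> t powi e r = \<omega> t powi (l + (e r - e q))" for t l
      unfolding \<omega>(2) using \<omega>(1)[of t] by (simp flip: power_int_add add: algebra_simps)
    have "(\<Sum>t<R. cnj (\<omega> t powi e q) * trig_eval n b (\<omega> t) * \<omega> t powi e r)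
        = (\<Sum>t<R. \<Sum>l\<in>I. b l * (cnj (\<omega> t powi e q) * \<omega> t powi l * \<omega> t powi e r))"
      by (simp add: trig_eval_def I_def sum_distrib_left sum_distrib_right mult_ac)
    also have "\<dots> = (\<Sum>l\<in>I. b l * (\<Sum>t<R. \<omega> t powi (l + (e r - e q))))"
      unfolding pw by (subst sum.swap) (simp add: sum_distrib_left)
    also have "\<dots> = (\<Sum>l\<in>I. if l = e q - e r then b l * of_nat R else 0)"
    proof (rule sum.cong[OF refl])
      fix l assume "l \<in> I"
      then have "\<bar>l + (e r - e q)\<bar> < int R"
        using eb[OF qr] by (auto simp: I_def R_def)
      from sum_roots_of_unity_powi[OF this]
      show "b l * (\<Sum>t<R. \<omega> t powi (l + (e r - e q))) = (if l = e q - e r then b l * of_nat R else 0)"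
        by (auto simp: \<omega>_def)
    qed
    \<comment> \<open>If \<open>e q - e r\<close> lies outside \<open>I\<close>, no term survives,
      and \<open>b\<close> vanishes there as well.\<close>
    also have "\<dots> = of_nat R * b (e q - e r)"
      using b[of "e q - e r"] by (auto simp: I_def)
    finally show ?thesis by (simp add: b_def)
  qed
  have "(\<Sum>t<R. form (\<omega> t)) = (\<Sum>q<K*k. \<Sum>r<K*k. cnj (v q) *
      (\<Sum>t<R. cnj (\<omega> t powi e q) * trig_eval n (a (q mod k) (r mod k)) (\<omega> t) * \<omega> t powi e r) * v r)"
    unfolding form_def
    by (subst sum.swap, rule sum.cong[OF refl], subst sum.swap)
      (simp add: sum_distrib_left sum_distrib_right mult_ac)
  also have "\<dots> = (\<Sum>q<K*k. \<Sum>r<K*k. cnj (v q) * (of_nat R * a (q mod k) (r mod k) (e q - e r)) * v r)"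
    by (intro sum.cong refl) (simp only: coeff lessThan_iff)
  also have "\<dots> = of_nat R * (\<Sum>q<K*k. \<Sum>r<K*k. cnj (v q) * a (q mod k) (r mod k) (e q - e r) * v r)"
    by (simp add: sum_distrib_left mult_ac)
  finally have eq: "(\<Sum>t<R. form (\<omega> t))
      = of_nat R * (\<Sum>q<K*k. \<Sum>r<K*k. cnj (v q) * a (q mod k) (r mod k) (e q - e r) * v r)" .
  define s where "s = (\<Sum>q<K*k. \<Sum>r<K*k. cnj (v q) * a (q mod k) (r mod k) (e q - e r) * v r)"
  have "Im (\<Sum>t<R. form (\<omega> t)) = 0" "Re (\<Sum>t<R. form (\<omega> t)) \<ge> 0"
    using form_pos by (simp_all add: \<omega>_def sum_nonneg)
  then have "Im s = 0 \<and> Re s \<ge> 0"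
    unfolding eq s_def[symmetric] using \<open>R > 0\<close> by (auto simp: zero_le_mult_iff)
  then show "Im (\<Sum>q<K*k. \<Sum>r<K*k. cnj (v q) * a (q mod k) (r mod k) ((int n - 1) * (int (q div k) - int (r div k))) * v r) = 0 \<and>
      0 \<le> Re (\<Sum>q<K*k. \<Sum>r<K*k. cnj (v q) * a (q mod k) (r mod k) ((int n - 1) * (int (q div k) - int (r div k))) * v r)"
    by (simp add: s_def e_def N_def right_diff_distrib)
qed

text \<open>An approximate Fejer--Riesz factorization, which needs no limit: a banded Cholesky
  factor of a block Toeplitz matrix with \<open>K + 1\<close> blocks has columns meeting only two consecutive
  blocks, here called \<open>\<alpha> r\<close> and \<open>\<beta> r\<close>. Summing along the block diagonals costs only the factor
  \<open>K / (K + 1)\<close> in the extreme coefficients.\<close>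

lemma approximate_fejer_riesz:
  fixes a :: "nat \<Rightarrow> nat \<Rightarrow> int \<Rightarrow> complex"
  assumes a: "pos_trig n k a" and "k > 0" "n \<ge> 2"
  shows "\<exists>(R :: nat) (\<alpha> :: nat \<Rightarrow> nat \<Rightarrow> complex) (\<beta> :: nat \<Rightarrow> nat \<Rightarrow> complex). \<forall>i<k. \<forall>j<k.
      of_nat (Suc K) * a i j 0 = (\<Sum>r<R. \<alpha> r i * cnj (\<alpha> r j) + \<beta> r i * cnj (\<beta> r j)) \<and>
      of_nat K * a i j (int n - 1) = (\<Sum>r<R. \<beta> r i * cnj (\<alpha> r j)) \<and>
      of_nat K * a i j (- (int n - 1)) = (\<Sum>r<R. \<alpha> r i * cnj (\<beta> r j))"
proof -
  define N where "N = int n - 1"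
  define R where "R = Suc K * k"
  define M where "M = (\<lambda>q r. a (q mod k) (r mod k) (N * (int (q div k) - int (r div k))))"
  \<comment> \<open>\<open>h r\<close> is the last index of the block following that of
    \<open>r\<close>.\<close>
  define h where "h = (\<lambda>r. (r div k + 2) * k - 1)"
  have hle: "i div k \<le> r div k + 1 \<longleftrightarrow> i \<le> h r" for i r
  proof -
    have "i div k \<le> r div k + 1 \<longleftrightarrow> i div k < r div k + 2" by linarith
    also have "\<dots> \<longleftrightarrow> i < (r div k + 2) * k" using \<open>k > 0\<close> by (rule div_less_iff_less_mult)
    also have "\<dots> \<longleftrightarrow> i \<le> h r" using \<open>k > 0\<close> by (auto simp: h_def)
    finally show ?thesis .
  qed
  have "mono h" by (auto simp: h_def mono_def intro!: diff_le_mono mult_le_mono1 div_le_mono)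
  moreover have "psd R M" unfolding M_def R_def N_def by (rule psd_block_toeplitz[OF a \<open>k > 0\<close>])
  moreover have "M i j = 0" if "h j < i" for i j
  proof -
    \<comment> \<open>Blocks at distance at least 2 carry frequencies of at least
      \<open>2 * (n - 1) \<ge> n\<close>, where all coefficients vanish.\<close>
    have "int (i div k) - int (j div k) \<ge> 2" using hle[of i j] that by linarith
    then have "N * (int (i div k) - int (j div k)) \<ge> N * 2"
      using \<open>n \<ge> 2\<close> by (intro mult_left_mono) (auto simp: N_def)
    then have "N * (int (i div k) - int (j div k)) \<ge> int n" using \<open>n \<ge> 2\<close> by (simp add: N_def)
    moreover have "trig_poly n (a (i mod k) (j mod k))"
      using a \<open>k > 0\<close> by (simp add: pos_trig_def mat_trig_def)
    ultimately show ?thesis by (simp add: M_def trig_poly_def)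
  qed
  ultimately obtain L where L: "\<And>i j. i < R \<Longrightarrow> j < R \<Longrightarrow> M i j = (\<Sum>r<R. L r i * cnj (L r j))"
    and L0: "\<And>r i. L r i \<noteq> 0 \<Longrightarrow> r \<le> i \<and> i \<le> h r"
    using banded_cholesky[of R M h] by blast
  define \<alpha> where "\<alpha> = (\<lambda>r i. L r (r div k * k + i))"
  \<comment> \<open>Block \<open>K\<close> is the last one and has no successor; the value 0 keeps
    entries of \<open>L\<close> at indices from \<open>R\<close> on out of the
    factorization.\<close>
  define \<beta> where "\<beta> = (\<lambda>r i. if r div k < K then L r (Suc (r div k) * k + i) else 0)"
  have supp: "J = r div k \<or> J = Suc (r div k)" if "L r (J * k + i) \<noteq> 0" "i < k" for r J i
  proof -
    have "(J * k + i) div k = J" using that by simp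
    with L0[OF that(1)] hle[of "J * k + i" r] div_le_mono[of r "J * k + i" k] show ?thesis by linarith
  qed
  have idx: "J * k + i < R" if "J < Suc K" "i < k" for i J
  proof -
    have "J * k + i < Suc J * k" using that by simp
    also have "\<dots> \<le> Suc K * k" using that by (intro mult_le_mono1) simp
    finally show ?thesis by (simp add: R_def)
  qed
  have blk: "r div k < Suc K" if "r < R" for r
    using that unfolding R_def by (rule less_mult_imp_div_less)
  have Mblk: "M (J * k + i) (J' * k + j) = a i j (N * (int J - int J'))"
    if "i < k" "j < k" for i j J J'
    using that by (simp add: M_def)
  have diag: "(\<Sum>J<Suc K. L r (J * k + i) * cnj (L r (J * k + j)))
      = \<alpha> r i * cnj (\<alpha> r j) + \<beta> r i * cnj (\<beta> r j)" if "r < R" "i < k" "j < k" for r i j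
  proof -
    have "(\<Sum>J<Suc K. L r (J * k + i) * cnj (L r (J * k + j)))
        = (\<Sum>J\<in>{r div k, Suc (r div k)} \<inter> {..<Suc K}. L r (J * k + i) * cnj (L r (J * k + j)))"
      using supp[OF _ that(2)] by (intro sum.mono_neutral_right) auto
    also have "{r div k, Suc (r div k)} \<inter> {..<Suc K} = (if r div k < K then {r div k, Suc (r div k)} else {r div k})"
      using blk[OF that(1)] by auto
    finally show ?thesis by (auto simp: \<alpha>_def \<beta>_def)
  qed
  have off: "(\<Sum>J<K. L r (Suc J * k + i) * cnj (L r (J * k + j))) = \<beta> r i * cnj (\<alpha> r j)"
    if "r < R" "i < k" "j < k" for r i j
  proof -
    have "(\<Sum>J<K. L r (Suc J * k + i) * cnj (L r (J * k + j)))
        = (\<Sum>J\<in>{r div k} \<inter> {..<K}. L r (Suc J * k + i) * cnj (L r (J * k + j)))"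
    proof (rule sum.mono_neutral_right)
      show "\<forall>J\<in>{..<K} - {r div k} \<inter> {..<K}. L r (Suc J * k + i) * cnj (L r (J * k + j)) = 0"
      proof
        fix J assume J: "J \<in> {..<K} - {r div k} \<inter> {..<K}"
        show "L r (Suc J * k + i) * cnj (L r (J * k + j)) = 0"
        proof (rule ccontr)
          assume "L r (Suc J * k + i) * cnj (L r (J * k + j)) \<noteq> 0"
          then have "L r (Suc J * k + i) \<noteq> 0 \<and> L r (J * k + j) \<noteq> 0"
            by (simp only: mult_eq_0_iff complex_cnj_zero_iff de_Morgan_disj simp_thms)
          then have "L r (Suc J * k + i) \<noteq> 0" "L r (J * k + j) \<noteq> 0" by blast+
          from supp[OF this(1) that(2)] supp[OF this(2) that(3)] J show False by auto
        qed
      qed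
    qed auto
    also have "{r div k} \<inter> {..<K} = (if r div k < K then {r div k} else {})" by auto
    finally show ?thesis by (auto simp: \<alpha>_def \<beta>_def)
  qed
  show ?thesis
  proof (rule exI[of _ R], rule exI[of _ \<alpha>], rule exI[of _ \<beta>], intro allI impI conjI)
    fix i j assume ij: "i < k" "j < k"
    \<comment> \<open>The main block diagonal holds \<open>K + 1\<close> copies of the constant
      coefficient, each neighbouring one \<open>K\<close> copies of an extreme coefficient.\<close>
    have "of_nat (Suc K) * a i j 0 = (\<Sum>J<Suc K. M (J * k + i) (J * k + j))"
      unfolding Mblk[OF ij] by simp
    also have "\<dots> = (\<Sum>J<Suc K. \<Sum>r<R. L r (J * k + i) * cnj (L r (J * k + j)))"
      by (intro sum.cong refl L idx ij) auto
    also have "\<dots> = (\<Sum>r<R. \<alpha> r i * cnj (\<alpha> r j) + \<beta> r i * cnj (\<beta> r j))"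
      by (subst sum.swap) (intro sum.cong refl diag ij, simp)
    finally show "of_nat (Suc K) * a i j 0 = (\<Sum>r<R. \<alpha> r i * cnj (\<alpha> r j) + \<beta> r i * cnj (\<beta> r j))" .
    have "of_nat K * a i j N = (\<Sum>J<K. M (Suc J * k + i) (J * k + j))"
      unfolding Mblk[OF ij] by simp
    also have "\<dots> = (\<Sum>J<K. \<Sum>r<R. L r (Suc J * k + i) * cnj (L r (J * k + j)))"
      by (intro sum.cong refl L idx ij) auto
    also have "\<dots> = (\<Sum>r<R. \<beta> r i * cnj (\<alpha> r j))"
      by (subst sum.swap) (intro sum.cong refl off ij, simp)
    finally show "of_nat K * a i j (int n - 1) = (\<Sum>r<R. \<beta> r i * cnj (\<alpha> r j))" by (simp add: N_def)
    have "of_nat K * a i j (- N) = (\<Sum>J<K. M (J * k + i) (Suc J * k + j))"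
      unfolding Mblk[OF ij] by simp
    also have "\<dots> = (\<Sum>J<K. \<Sum>r<R. L r (J * k + i) * cnj (L r (Suc J * k + j)))"
      by (intro sum.cong refl L idx ij) auto
    \<comment> \<open>The sum above the diagonal is the conjugate of the one below it with
      \<open>i\<close> and \<open>j\<close> exchanged, so \<open>off\<close> applies again.\<close>
    also have "\<dots> = (\<Sum>r<R. cnj (\<Sum>J<K. L r (Suc J * k + j) * cnj (L r (J * k + i))))"
      by (subst sum.swap) (simp add: mult.commute)
    also have "\<dots> = (\<Sum>r<R. cnj (\<beta> r j * cnj (\<alpha> r i)))"
      by (intro sum.cong refl arg_cong[where f = cnj] off ij) simp
    finally show "of_nat K * a i j (- (int n - 1)) = (\<Sum>r<R. \<alpha> r i * cnj (\<beta> r j))"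
      by (simp add: N_def mult.commute)
  qed
qed


section \<open>A functional nonnegative on compressed tensor products\<close>

lemma sum_swap_pairs:
  "(\<Sum>x\<in>A. \<Sum>y\<in>B. \<Sum>u\<in>C. \<Sum>v\<in>D. f x y u v) = (\<Sum>u\<in>C. \<Sum>v\<in>D. \<Sum>x\<in>A. \<Sum>y\<in>B. f x y u v)"
proof -
  have *: "(\<Sum>x\<in>S. \<Sum>u\<in>C. \<Sum>v\<in>D. g x u v) = (\<Sum>u\<in>C. \<Sum>v\<in>D. \<Sum>x\<in>S. g x u v)" for S and g :: "_ \<Rightarrow> _ \<Rightarrow> _ \<Rightarrow> _"
    by (subst sum.swap) (intro sum.cong refl sum.swap)
  show ?thesis by (simp only: *)
qed

text \<open>Only the constant and corner coefficients of \<open>\<delta>\<^sup>*(a \<otimes> b)\<delta>\<close> enter, paired with the anticommuting unitaries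
  \<open>diag(1, -1)\<close> and the flip. On a product of squares of linear polynomials this functional is a sum
  of four squares.\<close>

lemma compression_functional_nonneg:
  fixes a b :: "nat \<Rightarrow> nat \<Rightarrow> int \<Rightarrow> complex" and \<delta> :: "nat \<times> nat \<Rightarrow> nat \<Rightarrow> complex" and K :: nat
  assumes a: "pos_trig n k a" "k > 0" "n \<ge> 2" and b: "pos_trig m l b" "l > 0" "m \<ge> 2"
  defines "N \<equiv> int n - 1" and "M \<equiv> int m - 1"
    and "Y \<equiv> \<lambda>r s j t. \<Sum>x\<in>{..<k} \<times> {..<l}. \<Sum>y\<in>{..<k} \<times> {..<l}.
                cnj (\<delta> x r) * (a (fst x) (fst y) j * b (snd x) (snd y) t) * \<delta> y s"
  shows "0 \<le> Re ((of_nat (Suc K))\<^sup>2 * (Y 0 0 0 0 + Y 1 1 0 0)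
    + (of_nat K)\<^sup>2 * (Y 0 0 N M - Y 1 1 N M + Y 0 0 (-N) (-M) - Y 1 1 (-N) (-M)
        + Y 0 1 N (-M) + Y 1 0 N (-M) + Y 0 1 (-N) M + Y 1 0 (-N) M))"
proof -
  obtain R and \<alpha> \<beta> :: "nat \<Rightarrow> nat \<Rightarrow> complex" where fr_a: "\<forall>i<k. \<forall>j<k.
      of_nat (Suc K) * a i j 0 = (\<Sum>r<R. \<alpha> r i * cnj (\<alpha> r j) + \<beta> r i * cnj (\<beta> r j)) \<and>
      of_nat K * a i j N = (\<Sum>r<R. \<beta> r i * cnj (\<alpha> r j)) \<and>
      of_nat K * a i j (- N) = (\<Sum>r<R. \<alpha> r i * cnj (\<beta> r j))"
    using approximate_fejer_riesz[OF a, of K, folded N_def] by (elim exE) (rule that)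
  have a0: "of_nat (Suc K) * a i j 0 = (\<Sum>r<R. \<alpha> r i * cnj (\<alpha> r j) + \<beta> r i * cnj (\<beta> r j))"
    and a1: "of_nat K * a i j N = (\<Sum>r<R. \<beta> r i * cnj (\<alpha> r j))"
    and a2: "of_nat K * a i j (- N) = (\<Sum>r<R. \<alpha> r i * cnj (\<beta> r j))"
    if "i < k" "j < k" for i j using fr_a that by blast+
  obtain S and \<alpha>' \<beta>' :: "nat \<Rightarrow> nat \<Rightarrow> complex" where fr_b: "\<forall>i<l. \<forall>j<l.
      of_nat (Suc K) * b i j 0 = (\<Sum>r<S. \<alpha>' r i * cnj (\<alpha>' r j) + \<beta>' r i * cnj (\<beta>' r j)) \<and>
      of_nat K * b i j M = (\<Sum>r<S. \<beta>' r i * cnj (\<alpha>' r j)) \<and>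
      of_nat K * b i j (- M) = (\<Sum>r<S. \<alpha>' r i * cnj (\<beta>' r j))"
    using approximate_fejer_riesz[OF b, of K, folded M_def] by (elim exE) (rule that)
  have b0: "of_nat (Suc K) * b i j 0 = (\<Sum>r<S. \<alpha>' r i * cnj (\<alpha>' r j) + \<beta>' r i * cnj (\<beta>' r j))"
    and b1: "of_nat K * b i j M = (\<Sum>r<S. \<beta>' r i * cnj (\<alpha>' r j))"
    and b2: "of_nat K * b i j (- M) = (\<Sum>r<S. \<alpha>' r i * cnj (\<beta>' r j))"
    if "i < l" "j < l" for i j using fr_b that by blast+
  define X where "X = {..<k} \<times> {..<l}"
  \<comment> \<open>\<open>G p q u v\<close> is the vector
    \<open>\<delta>\<^sup>* (p u \<otimes> q v)\<close>, \<open>T\<close> sums rank one products of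
    such vectors, and \<open>W A B\<close> is the compression of \<open>A \<otimes> B\<close> by
    \<open>\<delta>\<close>.\<close>
  define G where "G = (\<lambda>(p :: nat \<Rightarrow> nat \<Rightarrow> complex) (q :: nat \<Rightarrow> nat \<Rightarrow> complex) (u :: nat) (v :: nat) r. \<Sum>x\<in>X. cnj (\<delta> x r) * (p u (fst x) * q v (snd x)))"
  define T where "T = (\<lambda>p p' q q' r s. \<Sum>u<R. \<Sum>v<S. G p p' u v r * cnj (G q q' u v s))"
  define W where "W = (\<lambda>A B r s. \<Sum>x\<in>X. \<Sum>y\<in>X. cnj (\<delta> x r) * (A (fst x) (fst y) * B (snd x) (snd y)) * \<delta> y s)"
  have W_T: "W (\<lambda>i j. \<Sum>u<R. p u i * cnj (q u j)) (\<lambda>i j. \<Sum>v<S. p' v i * cnj (q' v j)) r s = T p p' q q' r s"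
    for p p' q q' r s
    unfolding W_def T_def G_def cnj_sum sum_product sum_distrib_left sum_distrib_right
    by (subst sum_swap_pairs, rule sum.cong[OF refl], rule sum.cong[OF refl], subst sum.swap, intro sum.cong refl) (simp add: mult_ac)
  have W_cong: "W A B r s = W A' B' r s"
    if "\<And>i j. i < k \<Longrightarrow> j < k \<Longrightarrow> A i j = A' i j" "\<And>i j. i < l \<Longrightarrow> j < l \<Longrightarrow> B i j = B' i j" for A A' B B' r s
    unfolding W_def by (intro sum.cong refl) (auto simp: X_def that)
  \<comment> \<open>One factor \<open>c\<close> goes to \<open>a\<close> and one to
    \<open>b\<close>, matching the multiples \<open>K\<close> and \<open>Suc K\<close> in the two
    factorizations.\<close>
  have Y_W: "c\<^sup>2 * Y r s j t = W (\<lambda>i i'. c * a i i' j) (\<lambda>i i'. c * b i i' t) r s" for c r s j t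
    by (simp add: Y_def W_def X_def sum_distrib_left power2_eq_square mult_ac)
  have corner: "(of_nat K)\<^sup>2 * Y r s N M = T \<beta> \<beta>' \<alpha> \<alpha>' r s"
    "(of_nat K)\<^sup>2 * Y r s (- N) (- M) = T \<alpha> \<alpha>' \<beta> \<beta>' r s"
    "(of_nat K)\<^sup>2 * Y r s N (- M) = T \<beta> \<alpha>' \<alpha> \<beta>' r s"
    "(of_nat K)\<^sup>2 * Y r s (- N) M = T \<alpha> \<beta>' \<beta> \<alpha>' r s" for r s
    unfolding Y_W W_T[symmetric] by (intro W_cong a1 a2 b1 b2; assumption)+
  have center: "(of_nat (Suc K))\<^sup>2 * Y r s 0 0
      = T \<alpha> \<alpha>' \<alpha> \<alpha>' r s + T \<alpha> \<beta>' \<alpha> \<beta>' r s + T \<beta> \<alpha>' \<beta> \<alpha>' r s + T \<beta> \<beta>' \<beta> \<beta>' r s" for r s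
  proof -
    have "(of_nat (Suc K))\<^sup>2 * Y r s 0 0
        = W (\<lambda>i j. \<Sum>r<R. \<alpha> r i * cnj (\<alpha> r j) + \<beta> r i * cnj (\<beta> r j))
            (\<lambda>i j. \<Sum>r<S. \<alpha>' r i * cnj (\<alpha>' r j) + \<beta>' r i * cnj (\<beta>' r j)) r s"
      unfolding Y_W by (intro W_cong a0 b0; assumption)
    also have "\<dots> = T \<alpha> \<alpha>' \<alpha> \<alpha>' r s + T \<alpha> \<beta>' \<alpha> \<beta>' r s + T \<beta> \<alpha>' \<beta> \<alpha>' r s + T \<beta> \<beta>' \<beta> \<beta>' r s"
      unfolding W_T[symmetric] unfolding W_def sum.distrib by (simp only: distrib_left distrib_right sum.distrib add_ac)
    finally show ?thesis .
  qed
  \<comment> \<open>The cross terms of the first two squares yield the coefficients at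
    \<open>(N, M)\<close> and \<open>(-N, -M)\<close> with the signs of \<open>diag(1, -1)\<close>;
    those of the last two yield the other corners with indices 0 and 1 flipped. The remaining terms
    add up to the constant coefficients.\<close>
  define E where "E = (\<lambda>u v.
      (G \<beta> \<beta>' u v 0 + G \<alpha> \<alpha>' u v 0) * cnj (G \<beta> \<beta>' u v 0 + G \<alpha> \<alpha>' u v 0)
    + (G \<beta> \<beta>' u v 1 - G \<alpha> \<alpha>' u v 1) * cnj (G \<beta> \<beta>' u v 1 - G \<alpha> \<alpha>' u v 1)
    + (G \<beta> \<alpha>' u v 0 + G \<alpha> \<beta>' u v 1) * cnj (G \<beta> \<alpha>' u v 0 + G \<alpha> \<beta>' u v 1)
    + (G \<beta> \<alpha>' u v 1 + G \<alpha> \<beta>' u v 0) * cnj (G \<beta> \<alpha>' u v 1 + G \<alpha> \<beta>' u v 0))"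
  have "(of_nat (Suc K))\<^sup>2 * (Y 0 0 0 0 + Y 1 1 0 0)
    + (of_nat K)\<^sup>2 * (Y 0 0 N M - Y 1 1 N M + Y 0 0 (-N) (-M) - Y 1 1 (-N) (-M)
        + Y 0 1 N (-M) + Y 1 0 N (-M) + Y 0 1 (-N) M + Y 1 0 (-N) M) = (\<Sum>u<R. \<Sum>v<S. E u v)"
    unfolding distrib_left right_diff_distrib corner center
    by (simp add: E_def T_def sum.distrib sum_subtractf algebra_simps)
  moreover have "Re (E u v) \<ge> 0" for u v
    unfolding E_def complex_norm_square[symmetric] by (simp flip: of_real_power)
  ultimately show ?thesis by (simp add: sum_nonneg)
qed

section \<open>The pointwise positive witness and the contradiction\<close>

text \<open>The determinant \<open>9/4 - x\<^sup>2 - y\<^sup>2\<close> is at least 1/4. Multiplying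
  by the positive pivot \<open>3/2 - x\<close> completes the square.\<close>

lemma two_by_two_form_nonneg:
  fixes x y :: real
  assumes "\<bar>x\<bar> \<le> 1" "\<bar>y\<bar> \<le> 1"
  shows "0 \<le> (3/2 - x) * a\<^sup>2 + (3/2 + x) * c\<^sup>2 - 2 * y * (a * c)"
proof -
  have "x\<^sup>2 \<le> 1" "y\<^sup>2 \<le> 1" using assms by (simp_all add: abs_square_le_1)
  then have "0 \<le> ((3/2 - x) * a - y * c)\<^sup>2 + (9/4 - x\<^sup>2 - y\<^sup>2) * c\<^sup>2" by simp
  also have "\<dots> = (3/2 - x) * ((3/2 - x) * a\<^sup>2 + (3/2 + x) * c\<^sup>2 - 2 * y * (a * c))"
    by (simp add: power2_eq_square field_simps)
  finally have "0 \<le> (3/2 - x) * ((3/2 - x) * a\<^sup>2 + (3/2 + x) * c\<^sup>2 - 2 * y * (a * c))" .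
  moreover have "3/2 - x > 0" using assms by linarith
  ultimately show ?thesis using mult_pos_neg by (meson not_le)
qed

text \<open>The witness is \<open>3/2 - Re(z\<^sup>N w\<^sup>M) diag(1, -1) - Re(z\<^sup>N w\<^sup>-\<^sup>M) flip\<close>: the two matrices anticommute, so
  pointwise the last two terms have norm at most \<open>sqrt 2 < 3/2\<close>.\<close>

theorem theorem6p5:
  fixes n m :: nat
  assumes "n \<ge> 2" and "m \<ge> 2"
  shows "\<not> (\<forall>p X. mat_tens n m p X \<longrightarrow> (min_pos n m p X \<longleftrightarrow> max_pos n m p X))"
proof
  assume eq: "\<forall>p X. mat_tens n m p X \<longrightarrow> (min_pos n m p X \<longleftrightarrow> max_pos n m p X)"
  define N where "N = int n - 1"
  define M where "M = int m - 1"
  have NM: "N > 0" "M > 0" using assms by (auto simp: N_def M_def)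
  \<comment> \<open>Each real part is half the sum of a monomial and its adjoint, whence the entries
    of modulus 1/2. As \<open>N\<close> and \<open>M\<close> are positive, the cases do not
    overlap.\<close>
  define X :: "nat \<Rightarrow> nat \<Rightarrow> int \<Rightarrow> int \<Rightarrow> complex" where "X = (\<lambda>r s j t.
     if j = 0 \<and> t = 0 then (if r = s then 3/2 else 0)
     else if j = N \<and> t = M \<or> j = - N \<and> t = - M then (if r = s then (if r = 0 then - 1/2 else 1/2) else 0)
     else if j = N \<and> t = - M \<or> j = - N \<and> t = M then (if r = s then 0 else - 1/2)
     else 0)"
  have tens: "mat_tens n m 2 X"
    using assms by (auto simp: mat_tens_def trig2_def X_def N_def M_def)
  have eval: "trig2_eval n m (X r s) z w = (if r = s then 3/2 + (if r = 0 then - 1 else 1) * of_real (Re (z powi N * w powi M))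
       else - of_real (Re (z powi N * w powi (- M))))"
    if z: "cmod z = 1" and w: "cmod w = 1" for r s z w
  proof -
    have inner: "(\<Sum>t\<in>{-(int m)<..<int m}. f t) = f (-M) + f 0 + f M"
      if "\<And>t. t \<noteq> 0 \<Longrightarrow> t \<noteq> M \<Longrightarrow> t \<noteq> - M \<Longrightarrow> f t = 0" for f :: "int \<Rightarrow> complex"
    proof -
      have "(\<Sum>t\<in>{-(int m)<..<int m}. f t) = (\<Sum>t\<in>{-M,0,M}. f t)"
        by (rule sum.mono_neutral_right) (use that assms in \<open>auto simp: M_def\<close>)
      then show ?thesis using NM by (simp add: add_ac)
    qed
    have outer: "(\<Sum>t\<in>{-(int n)<..<int n}. f t) = f (-N) + f 0 + f N"
      if "\<And>t. t \<noteq> 0 \<Longrightarrow> t \<noteq> N \<Longrightarrow> t \<noteq> - N \<Longrightarrow> f t = 0" for f :: "int \<Rightarrow> complex"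
    proof -
      have "(\<Sum>t\<in>{-(int n)<..<int n}. f t) = (\<Sum>t\<in>{-N,0,N}. f t)"
        by (rule sum.mono_neutral_right) (use that assms in \<open>auto simp: N_def\<close>)
      then show ?thesis using NM by (simp add: add_ac)
    qed
    have cnj_powi: "u powi (- l) = cnj (u powi l)" if "cmod u = 1" for u l
    proof -
      have "inverse u = cnj u" using that by (simp add: inverse_eq_divide divide_conv_cnj)
      then show ?thesis by (simp add: power_int_minus flip: power_int_inverse)
    qed
    define P where "P = z powi N"
    define Q where "Q = w powi M"
    have ev: "trig2_eval n m (X r s) z w = X r s (- N) (- M) * cnj P * cnj Q + X r s (- N) M * cnj P * Q
        + X r s 0 0 + X r s N (- M) * P * cnj Q + X r s N M * P * Q"
      unfolding trig2_eval_def P_def Q_def cnj_powi[OF z, symmetric] cnj_powi[OF w, symmetric]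
      by (subst outer, (simp add: X_def), (subst inner, simp add: X_def)+)
        (use NM in \<open>simp add: X_def\<close>)
    show ?thesis
      unfolding ev cnj_powi[OF z] cnj_powi[OF w] P_def[symmetric] Q_def[symmetric]
      using NM by (auto simp: X_def complex_eq_iff field_simps)
  qed
  have "min_pos n m 2 X"
    unfolding min_pos_def psd_def Let_def
  proof (intro allI impI)
    fix z w :: complex and v :: "nat \<Rightarrow> complex"
    assume zw: "cmod z = 1" "cmod w = 1"
    define x where "x = Re (z powi N * w powi M)"
    define y where "y = Re (z powi N * w powi (- M))"
    have "\<bar>x\<bar> \<le> 1" "\<bar>y\<bar> \<le> 1"
      using abs_Re_le_cmod[of "z powi N * w powi M"] abs_Re_le_cmod[of "z powi N * w powi (- M)"] zw
      by (simp_all add: x_def y_def norm_mult norm_power_int)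
    note pos = two_by_two_form_nonneg[OF this]
    have s: "(\<Sum>i<2. \<Sum>j<2. cnj (v i) * trig2_eval n m (X i j) z w * v j)
        = cnj (v 0) * (3/2 - x) * v 0 + cnj (v 1) * (3/2 + x) * v 1 - y * (cnj (v 0) * v 1 + cnj (v 1) * v 0)"
      by (simp add: eval[OF zw] x_def y_def numeral_2_eq_2 algebra_simps)
    \<comment> \<open>The matrix is real symmetric, so the real and imaginary parts of
      \<open>v\<close> contribute separately.\<close>
    show "Im (\<Sum>i<2. \<Sum>j<2. cnj (v i) * trig2_eval n m (X i j) z w * v j) = 0 \<and>
        0 \<le> Re (\<Sum>i<2. \<Sum>j<2. cnj (v i) * trig2_eval n m (X i j) z w * v j)"
      unfolding s using add_mono[OF pos[of "Re (v 0)" "Re (v 1)"] pos[of "Im (v 0)" "Im (v 1)"]]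
      by (simp add: power2_eq_square algebra_simps add_divide_distrib)
  qed
  with eq tens have "max_pos n m 2 X" by blast
  \<comment> \<open>Without damping the functional is \<open>3 - 4 = - 1\<close> at
    \<open>X\<close>, and \<epsilon> adds \<open>2 * \<epsilon>\<close>; the choice 1/4 leaves
    \<open>- 1/2\<close>.\<close>
  have "(1/4 :: real) > 0" by simp
  from mp[OF spec[OF \<open>max_pos n m 2 X\<close>[unfolded max_pos_def]] this]
  obtain k l a b and \<delta> :: "nat \<times> nat \<Rightarrow> nat \<Rightarrow> complex" where
    *: "k > 0 \<and> l > 0 \<and> pos_trig n k a \<and> pos_trig m l b \<and>
          (\<forall>r<2. \<forall>s<2. \<forall>j t.
             (if r = s \<and> j = 0 \<and> t = 0 then complex_of_real (1/4) else 0) + X r s j t =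
             (\<Sum>x\<in>{..<k} \<times> {..<l}. \<Sum>y\<in>{..<k} \<times> {..<l}.
                cnj (\<delta> x r) * (a (fst x) (fst y) j * b (snd x) (snd y) t) * \<delta> y s))"
    by (elim exE) (rule that)
  then have k: "k > 0" and l: "l > 0" and a: "pos_trig n k a" and b: "pos_trig m l b" by simp_all
  note Y = *[THEN conjunct2, THEN conjunct2, THEN conjunct2, THEN conjunct2]
  define Z where "Z r s j t = (\<Sum>x\<in>{..<k} \<times> {..<l}. \<Sum>y\<in>{..<k} \<times> {..<l}.
      cnj (\<delta> x r) * (a (fst x) (fst y) j * b (snd x) (snd y) t) * \<delta> y s)" for r s j t
  have Z: "Z r s j t = (if r = s \<and> j = 0 \<and> t = 0 then 1/4 else 0) + X r s j t" if "r < 2" "s < 2" for r s j t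
    unfolding Z_def Y[rule_format, OF that, symmetric] by simp
  \<comment> \<open>The undamped functional is \<open>7/2 - 4 < 0\<close> here; \<open>K = 19\<close> is large enough to keep the sign:
    \<open>20\<^sup>2 * 7/2 - 19\<^sup>2 * 4 = - 44\<close>.\<close>
  have "0 \<le> Re ((of_nat (Suc 19))\<^sup>2 * (Z 0 0 0 0 + Z 1 1 0 0)
      + (of_nat 19)\<^sup>2 * (Z 0 0 N M - Z 1 1 N M + Z 0 0 (-N) (-M) - Z 1 1 (-N) (-M)
        + Z 0 1 N (-M) + Z 1 0 N (-M) + Z 0 1 (-N) M + Z 1 0 (-N) M))"
    unfolding Z_def N_def M_def by (rule compression_functional_nonneg[OF a k assms(1) b l assms(2)])
  also have "\<dots> = - 44"
    using NM by (simp add: Z X_def)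
  finally show False by simp
qed

end
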